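(* Let $N\ge 1$, let $T:\mathbb{R}_+^N\to\mathbb{R}_{++}^N$ be a continuous concave mapping with lower bounding matrix $M\in\mathbb{R}_+^{N\times N}$, let $\rho(M)$ denote the spectral radius of $M$, and let $\|\cdot\|_a$ and $\|\cdot\|_b$ be monotone norms on $\mathbb{R}^N$. Let $E:\mathbb{R}_{++}\to\mathbb{R}_{++}$ be the $\|\cdot\|_b$-energy efficiency function associated with the canonical utility maximization problem for $T$ and $\|\cdot\|_a$. Then: (i) (Lower bound) Let $\alpha_1\in\mathbb{R}_{++}$ be an arbitrary scalar satisfying $\alpha_1\|p\|_b\le\|p\|_a$ for every $p\in\mathbb{R}^N$, and $\beta\in\mathbb{R}_{++}$ an arbitrary scalar satisfying $\|p\|_\infty\le\beta\|p\|_a$ for every $p\in\mathbb{R}_{++}^N$. Then for every $\bar p\in\mathbb{R}_{++}$, $$\frac{\alpha_1}{\|T(\bar p\beta\mathbf{1})\|_a}\le E(\bar p).$$ (ii) (Upper bound) Assume that $\rho(M)>0$, and let $\alpha_2\in\mathbb{R}_{++}$ be an arbitrary scalar satisfying $\|p\|_a\le\alpha_2\|p\|_b$ for every $p\in\mathbb{R}^N$. Then for every $\bar p\in\mathbb{R}_{++}$, $$E(\bar p)<\frac{\alpha_2}{\rho(M)\,\bar p}.$$ (iii) (Maximum energy efficiency) $$\lim_{\bar p\to0^+}E(\bar p)=\sup_{\bar p>0}E(\bar p)=\frac{1}{\|T(0)\|_b}.$$ (iv) (Combined upper bound) Assume that $\rho(M)>0$, let $\alpha_2\in\mathbb{R}_{++}$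 be as in (ii), and let $k:=\|T(0)\|_b/\rho(M)$. Then for every $\bar p\in\mathbb{R}_{++}$, $$E(\bar p)\le\begin{cases}\dfrac{\alpha_2}{\rho(M)\,\bar p} & \text{if }\bar p\ge k,\\[2mm] \dfrac{1}{\|T(0)\|_b} & \text{otherwise.}\end{cases}$$
   Context: Notation: $\mathbb{R}_+=[0,\infty)$, $\mathbb{R}_{++}=(0,\infty)$; vector inequalities are entrywise; $\mathbf{1}\in\mathbb{R}^N$ is the all-ones vector and $e_j$ the $j$th standard basis vector. A mapping $T:\mathbb{R}_+^N\to\mathbb{R}^N$ is concave if $T(\alpha x+(1-\alpha)y)\ge \alpha T(x)+(1-\alpha)T(y)$ for all $x,y\in\mathbb{R}_+^N$, $\alpha\in(0,1)$. A norm $\|\cdot\|$ on $\mathbb{R}^N$ is monotone if for all $x,y\in\mathbb{R}_+^N$, $x\ge y$ implies $\|x\|\ge\|y\|$. Canonical utility maximization problem: given a power budget $\bar p\in\mathbb{R}_{++}$, maximize $c$ over $(p,c)\in\mathbb{R}_+^N\times\mathbb{R}_{++}$ subject to $p=cT(p)$ and $\|p\|_a\le\bar p$. It is known that for every $\bar p>0$ this problem has a unique solution $(p^\star_{\bar p},c^\star_{\bar p})\in\mathbb{R}_{++}^N\times\mathbb{R}_{++}$, and that it is also the unique pair satisfying $T(p)=\frac1c p$ and $\|p\|_a=\bar p$. The utility function is $U:\mathbb{R}_{++}\to\mathbb{R}_{++}$, $U(\bar p)=c^\star_{\bar p}$, and the power function is $P:\mathbb{R}_{++}\to\mathbb{R}_{++}^N$,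 $P(\bar p)=p^\star_{\bar p}$. The $\|\cdot\|_b$-energy efficiency function is $E:\mathbb{R}_{++}\to\mathbb{R}_{++}$, $E(\bar p)=U(\bar p)/\|P(\bar p)\|_b$ (equivalently $1/\|T(P(\bar p))\|_b$). Lower bounding matrix: for a continuous concave $T=[t_1,\ldots,t_N]:\mathbb{R}_+^N\to\mathbb{R}_{++}^N$, it is the matrix $M\in\mathbb{R}_+^{N\times N}$ with entries $[M]_{i,j}=\lim_{h\to0^+}h\,t_i(h^{-1}e_j)$ (the limits exist and are finite and non-negative). *)

theory Defs
  imports "HOL-Analysis.Analysis" "Jordan_Normal_Form.Spectral_Radius"
begin

no_notation vec_index (infixl "$" 100)

text \<open>The order \<open>\<le>\<close> on \<open>real ^ 'n\<close> is the entrywise one, but \<open><\<close> is its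
  strict part (\<open>\<le>\<close> and \<open>\<noteq>\<close>); strict entrywise inequalities are therefore written out.\<close>

definition concave_mapping :: "(real ^ 'n \<Rightarrow> real ^ 'n) \<Rightarrow> bool" where
  "concave_mapping T \<longleftrightarrow>
     (\<forall>x\<ge>0. \<forall>y\<ge>0. \<forall>\<alpha>. 0 < \<alpha> \<and> \<alpha> < 1 \<longrightarrow>
        T (\<alpha> *\<^sub>R x + (1 - \<alpha>) *\<^sub>R y) \<ge> \<alpha> *\<^sub>R T x + (1 - \<alpha>) *\<^sub>R T y)"

definition is_norm :: "('a::real_vector \<Rightarrow> real) \<Rightarrow> bool" where
  "is_norm \<nu> \<longleftrightarrow>
     (\<forall>x. 0 \<le> \<nu> x) \<and> (\<forall>x. \<nu> x = 0 \<longleftrightarrow> x = 0) \<and>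
     (\<forall>a x. \<nu> (a *\<^sub>R x) = \<bar>a\<bar> * \<nu> x) \<and> (\<forall>x y. \<nu> (x + y) \<le> \<nu> x + \<nu> y)"

definition monotone_norm :: "(real ^ 'n \<Rightarrow> real) \<Rightarrow> bool" where
  "monotone_norm \<nu> \<longleftrightarrow> is_norm \<nu> \<and> (\<forall>x\<ge>0. \<forall>y\<ge>0. x \<ge> y \<longrightarrow> \<nu> x \<ge> \<nu> y)"

definition lower_bounding_matrix :: "(real ^ 'n \<Rightarrow> real ^ 'n) \<Rightarrow> real ^ 'n ^ 'n" where
  "lower_bounding_matrix T =
     (\<chi> i j. Lim (at_right 0) (\<lambda>h. h * (T (inverse h *\<^sub>R axis j 1) $ i)))"

text \<open>The spectral radius of \<open>complex mat\<close> is transferred along an enumeration of the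
  index type by \<open>{..<CARD('n)}\<close>; a different enumeration gives a permutation-similar
  matrix, hence the same spectral radius.\<close>

definition complex_mat_of :: "real ^ 'n ^ 'n \<Rightarrow> complex mat" where
  "complex_mat_of A = Matrix.mat CARD('n) CARD('n)
     (\<lambda>(i, j). complex_of_real
        (A $ from_nat_into (UNIV :: 'n set) i $ from_nat_into (UNIV :: 'n set) j))"

definition rho :: "real ^ 'n ^ 'n \<Rightarrow> real" where
  "rho A = spectral_radius (complex_mat_of A)"

definition feasible ::
  "(real ^ 'n \<Rightarrow> real ^ 'n) \<Rightarrow> (real ^ 'n \<Rightarrow> real) \<Rightarrow> real \<Rightarrow> ((real ^ 'n) \<times> real) set" where
  "feasible T \<nu> pbar = {(p, c). p \<ge> 0 \<and> c > 0 \<and> p = c *\<^sub>R T p \<and> \<nu> p \<le> pbar}"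

text \<open>For a continuous concave \<open>T\<close>, positive on the nonnegative orthant, a monotone norm
  \<open>\<nu>\<close> and a positive budget, the maximizer exists and is unique, so \<open>THE\<close> denotes it.\<close>

definition solution ::
  "(real ^ 'n \<Rightarrow> real ^ 'n) \<Rightarrow> (real ^ 'n \<Rightarrow> real) \<Rightarrow> real \<Rightarrow> (real ^ 'n) \<times> real" where
  "solution T \<nu> pbar = (THE s. is_arg_max snd (\<lambda>s. s \<in> feasible T \<nu> pbar) s)"

definition power_function ::
  "(real ^ 'n \<Rightarrow> real ^ 'n) \<Rightarrow> (real ^ 'n \<Rightarrow> real) \<Rightarrow> real \<Rightarrow> real ^ 'n" where
  "power_function T \<nu> pbar = fst (solution T \<nu> pbar)"

definition utility_function ::
  "(real ^ 'n \<Rightarrow> real ^ 'n) \<Rightarrow> (real ^ 'n \<Rightarrow> real) \<Rightarrow> real \<Rightarrow> real" where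
  "utility_function T \<nu> pbar = snd (solution T \<nu> pbar)"

definition energy_efficiency ::
  "(real ^ 'n \<Rightarrow> real ^ 'n) \<Rightarrow> (real ^ 'n \<Rightarrow> real) \<Rightarrow> (real ^ 'n \<Rightarrow> real) \<Rightarrow> real \<Rightarrow> real" where
  "energy_efficiency T \<nu>\<^sub>a \<nu>\<^sub>b pbar =
     utility_function T \<nu>\<^sub>a pbar / \<nu>\<^sub>b (power_function T \<nu>\<^sub>a pbar)"

end

theory Submission
  imports Defs
begin

text \<open>The solution for budget \<open>pbar\<close> is the Brouwer fixed point of
  \<open>p \<mapsto> (pbar / \<parallel>T p\<parallel>\<^sub>a) T p\<close>; strict
  subhomogeneity of \<open>T\<close> makes it unique, and there \<open>E pbar = 1 / \<parallel>T p\<parallel>\<^sub>b\<close>.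
  Monotonicity of \<open>T\<close> between \<open>0\<close>, \<open>p\<close> and
  \<open>pbar \<beta> 1\<close> then gives the lower bound and the bound by \<open>1 / \<parallel>T 0\<parallel>\<^sub>b\<close>,
  which is the limit because the solution tends to \<open>0\<close> with the budget.
  The remaining bound is Collatz--Wielandt: concavity gives
  \<open>T p \<ge> T 0 + M p\<close>, so \<open>M p\<close> is strictly below \<open>T p = p / c\<close> in every entry,
  and hence \<open>\<rho> M < 1 / c\<close>.\<close>

text \<open>Unqualified, \<open>less_eq_vec_def\<close> is the order on the vectors of \<open>Jordan_Normal_Form\<close>.\<close>
lemmas le_vec_iff = Finite_Cartesian_Product.less_eq_vec_def

section \<open>Spectral radius of a nonnegative matrix: a strict Collatz--Wielandt bound\<close>

lemma ex_maximizer: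
  fixes f :: "'n::finite \<Rightarrow> real"
  obtains i where "\<And>j. f j \<le> f i"
proof -
  have "Max (range f) \<in> range f" by (rule Max_in) auto
  then obtain i where i: "Max (range f) = f i" by (rule imageE)
  have "f j \<le> f i" for j unfolding i[symmetric] by (rule Max_ge) auto
  then show thesis by (rule that)
qed

text \<open>An eigenvector for an eigenvalue \<open>k\<close> of maximal modulus has entry moduli
  \<open>w\<close> with \<open>norm k * w\<close> at most \<open>M w\<close> entrywise. Scaling the
  positive test vector \<open>p\<close> until it just dominates \<open>w\<close> and reading this
  inequality at a point of contact gives \<open>norm k < r\<close>.\<close>

lemma rho_less:
  fixes M :: "real ^ 'n ^ 'n" and p :: "real ^ 'n"
  assumes nonneg: "\<And>i j. 0 \<le> M $ i $ j" and pos: "\<And>i. 0 < p $ i"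
    and less: "\<And>i. (M *v p) $ i < r * p $ i"
  shows "rho M < r"
proof -
  let ?n = "CARD('n)" and ?A = "complex_mat_of M"
  define e where "e = from_nat_into (UNIV :: 'n set)"
  have bij: "bij_betw e {..<?n} UNIV"
    unfolding e_def by (rule bij_betw_from_nat_into_finite) simp
  have A: "?A \<in> carrier_mat ?n ?n" by (simp add: complex_mat_of_def)
  have "rho M \<in> norm ` spectrum ?A"
    unfolding rho_def by (rule spectral_radius_mem_max(1)[OF A]) simp
  then obtain k where rho: "rho M = norm k" and "eigenvalue ?A k"
    by (auto simp: spectrum_def)
  then obtain v where v: "v \<in> carrier_vec ?n" "v \<noteq> 0\<^sub>v ?n" and ev: "?A *\<^sub>v v = k \<cdot>\<^sub>v v"
    using A unfolding eigenvalue_def eigenvector_def by auto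
  \<comment> \<open>The moduli are indexed by the type \<open>'n\<close> through the inverse of
    \<open>e\<close>, the enumeration built into \<open>complex_mat_of\<close>, so that they can be
    compared with \<open>p\<close>.\<close>
  define w where "w a = norm (vec_index v (inv_into {..<?n} e a))" for a
  have w_e: "w (e i) = norm (vec_index v i)" if "i < ?n" for i
    using bij_betw_inv_into_left[OF bij] that by (simp add: w_def)
  have w_le: "norm k * w a \<le> (\<Sum>b\<in>UNIV. M $ a $ b * w b)" for a
  proof -
    obtain i where i: "i < ?n" "a = e i"
      using bij by (metis bij_betw_def imageE UNIV_I lessThan_iff)
    have "norm k * w a = norm (vec_index (k \<cdot>\<^sub>v v) i)"
      using i v by (simp add: w_e norm_mult)
    also have "vec_index (k \<cdot>\<^sub>v v) i = (\<Sum>j<?n. complex_of_real (M $ a $ e j) * vec_index v j)"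
      unfolding ev[symmetric] using i v
      by (auto simp: complex_mat_of_def scalar_prod_def e_def atLeast0LessThan intro!: sum.cong)
    also have "norm \<dots> \<le> (\<Sum>j<?n. M $ a $ e j * w (e j))"
      by (rule order_trans[OF norm_sum]) (auto simp: norm_mult nonneg w_e intro!: sum_mono)
    also have "\<dots> = (\<Sum>b\<in>UNIV. M $ a $ b * w b)"
      by (rule sum.reindex_bij_betw[OF bij])
    finally show ?thesis .
  qed
  obtain a where a: "\<And>b. w b / p $ b \<le> w a / p $ a"
    using ex_maximizer[of "\<lambda>b. w b / p $ b"] by blast
  \<comment> \<open>This is the least factor for which \<open>s * p\<close> dominates
    \<open>w\<close>; equality holds at \<open>a\<close>.\<close>
  define s where "s = w a / p $ a"
  have ws: "w b \<le> s * p $ b" for b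
    using a[of b] pos[of b] by (simp add: s_def pos_divide_le_eq)
  \<comment> \<open>A nonzero eigenvector entry makes \<open>s\<close> positive, so that
    \<open>s * p $ a\<close> can be cancelled at the end.\<close>
  have "\<exists>i<?n. vec_index v i \<noteq> 0"
    using v by (metis carrier_vecD eq_vecI index_zero_vec)
  then obtain i where i: "i < ?n" "vec_index v i \<noteq> 0" by auto
  then have "0 < w (e i)" by (simp add: w_e)
  then have "0 < s * p $ e i" using ws[of "e i"] by linarith
  then have s: "0 < s" using pos[of "e i"] by (simp add: zero_less_mult_iff)
  have "norm k * (s * p $ a) = norm k * w a"
    using pos[of a] by (simp add: s_def)
  also have "\<dots> \<le> (\<Sum>b\<in>UNIV. M $ a $ b * w b)" by (rule w_le)
  also have "\<dots> \<le> (\<Sum>b\<in>UNIV. M $ a $ b * (s * p $ b))"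
    by (intro sum_mono mult_left_mono ws nonneg)
  also have "\<dots> = s * (M *v p) $ a"
    by (simp add: matrix_vector_mult_def sum_distrib_left mult_ac)
  also have "\<dots> < s * (r * p $ a)" using less s by simp
  finally have "norm k * (s * p $ a) < r * (s * p $ a)" by (simp add: mult_ac)
  then show ?thesis using s pos[of a] by (simp add: rho)
qed

section \<open>Monotone norms on Euclidean space\<close>

lemma is_norm_continuous:
  fixes \<nu> :: "'a::euclidean_space \<Rightarrow> real"
  assumes "is_norm \<nu>"
  shows "continuous_on S \<nu>"
proof -
  \<comment> \<open>Continuity comes from convexity: a finite convex function on an open set in
    finite dimension is continuous.\<close>
  have "convex_on UNIV \<nu>"
  proof (rule convex_onI)
    fix t :: real and x y :: 'a
    assume "0 < t" "t < 1"
    then show "\<nu> ((1 - t) *\<^sub>R x + t *\<^sub>R y) \<le> (1 - t) * \<nu> x + t * \<nu> y"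
      using assms unfolding is_norm_def
      by (metis abs_of_pos diff_gt_0_iff_gt)
  qed simp
  then have "continuous_on UNIV \<nu>" by (rule convex_on_continuous[OF open_UNIV])
  then show ?thesis by (rule continuous_on_subset) simp
qed

locale norm_mono =
  fixes \<nu> :: "real ^ 'n \<Rightarrow> real"
  assumes mono_norm: "monotone_norm \<nu>"
begin

lemma norm_properties: "is_norm \<nu>"
  using mono_norm by (simp add: monotone_norm_def)

lemma norm_scale: "0 \<le> a \<Longrightarrow> \<nu> (a *\<^sub>R x) = a * \<nu> x"
  using norm_properties by (simp add: is_norm_def)

lemma norm_triangle: "\<nu> (x + y) \<le> \<nu> x + \<nu> y"
  using norm_properties by (simp add: is_norm_def)

lemma norm_le: "0 \<le> x \<Longrightarrow> x \<le> y \<Longrightarrow> \<nu> x \<le> \<nu> y"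
  using mono_norm order_trans unfolding monotone_norm_def by blast

lemma norm_pos: "x \<noteq> 0 \<Longrightarrow> 0 < \<nu> x"
  using norm_properties unfolding is_norm_def by (metis order_le_less)

text \<open>Monotonicity applied to \<open>p $ i *\<^sub>R axis i 1\<close>, which lies below
  \<open>p\<close>. The estimate bounds norm balls in the orthant and later forces solutions to
  vanish with the budget.\<close>

lemma component_le: "0 \<le> p \<Longrightarrow> p $ i \<le> \<nu> p / \<nu> (axis i 1)"
proof -
  assume p: "0 \<le> p"
  have pos: "0 < \<nu> (axis i 1)" by (rule norm_pos) (simp add: axis_eq_0_iff)
  have "\<nu> (p $ i *\<^sub>R axis i 1) \<le> \<nu> p"
    using p by (intro norm_le) (auto simp: le_vec_iff axis_def)
  then have "p $ i * \<nu> (axis i 1) \<le> \<nu> p"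
    using p by (simp add: norm_scale le_vec_iff)
  then show ?thesis using pos by (simp add: pos_le_divide_eq)
qed

text \<open>These sets serve as the domain for Brouwer's theorem.\<close>

lemma norm_ball_compact_convex:
  "compact {p. 0 \<le> p \<and> \<nu> p \<le> B}" "convex {p. 0 \<le> p \<and> \<nu> p \<le> B}"
proof -
  have eq: "{p. 0 \<le> p \<and> \<nu> p \<le> B} = {p. 0 \<le> p} \<inter> {p. \<nu> p \<le> B}" by auto
  have "closed {p :: real ^ 'n. 0 \<le> p}"
    unfolding le_vec_iff
    by (intro closed_Collect_all closed_Collect_le continuous_intros)
  moreover have "closed {p. \<nu> p \<le> B}"
    by (intro closed_Collect_le continuous_intros is_norm_continuous norm_properties)
  moreover have "{p. 0 \<le> p \<and> \<nu> p \<le> B} \<subseteq> cbox 0 (\<chi> i. B / \<nu> (axis i 1))"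
  proof
    fix p assume p: "p \<in> {p. 0 \<le> p \<and> \<nu> p \<le> B}"
    have "p $ i \<le> B / \<nu> (axis i 1)" for i
    proof -
      have "p $ i \<le> \<nu> p / \<nu> (axis i 1)" using p component_le by auto
      also have "\<dots> \<le> B / \<nu> (axis i 1)"
        using p norm_properties by (intro divide_right_mono) (auto simp: is_norm_def)
      finally show ?thesis .
    qed
    then show "p \<in> cbox 0 (\<chi> i. B / \<nu> (axis i 1))"
      using p by (simp add: mem_box_cart le_vec_iff)
  qed
  ultimately show "compact {p. 0 \<le> p \<and> \<nu> p \<le> B}"
    unfolding eq compact_eq_bounded_closed
    using bounded_subset[OF bounded_cbox] closed_Int by blast
  show "convex {p. 0 \<le> p \<and> \<nu> p \<le> B}"
  proof (rule convexI)
    fix x y :: "real ^ 'n" and u v :: real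
    assume x: "x \<in> {p. 0 \<le> p \<and> \<nu> p \<le> B}" and y: "y \<in> {p. 0 \<le> p \<and> \<nu> p \<le> B}"
      and uv: "0 \<le> u" "0 \<le> v" "u + v = 1"
    have "\<nu> (u *\<^sub>R x + v *\<^sub>R y) \<le> u * \<nu> x + v * \<nu> y"
      using norm_triangle[of "u *\<^sub>R x" "v *\<^sub>R y"] uv by (simp add: norm_scale)
    also have "\<dots> \<le> B" using x y uv by (intro convex_bound_le) auto
    finally show "u *\<^sub>R x + v *\<^sub>R y \<in> {p. 0 \<le> p \<and> \<nu> p \<le> B}"
      using x y uv by (auto simp: le_vec_iff)
  qed
qed

end

section \<open>Positive concave mappings: monotonicity, subhomogeneity and comparison of fixed
  points\<close>

locale positive_concave =
  fixes T :: "real ^ 'n \<Rightarrow> real ^ 'n"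
  assumes concave: "concave_mapping T"
    and positive: "0 \<le> x \<Longrightarrow> 0 < T x $ i"
begin

lemma T_nonneg: "0 \<le> x \<Longrightarrow> 0 \<le> T x"
  using positive by (simp add: le_vec_iff less_imp_le)

lemma T_nonzero: "0 \<le> x \<Longrightarrow> T x \<noteq> 0"
  using positive by (metis less_irrefl zero_index)

lemma concave_component:
  assumes "0 \<le> x" "0 \<le> y" "0 < a" "a < 1"
  shows "a * T x $ i + (1 - a) * T y $ i \<le> T (a *\<^sub>R x + (1 - a) *\<^sub>R y) $ i"
proof -
  have "a *\<^sub>R T x + (1 - a) *\<^sub>R T y \<le> T (a *\<^sub>R x + (1 - a) *\<^sub>R y)"
    using concave assms unfolding concave_mapping_def by blast
  then show ?thesis by (simp add: le_vec_iff)
qed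

text \<open>A concave function bounded below on a ray cannot decrease along it: \<open>y\<close> is a
  convex combination of \<open>x\<close> and a far point \<open>z\<close> beyond \<open>y\<close>.\<close>
lemma T_mono_component:
  assumes x: "0 \<le> x" and xy: "x \<le> y"
  shows "T x $ i \<le> T y $ i"
proof (rule field_le_epsilon)
  fix d :: real
  assume d: "0 < d"
  define t where "t = T x $ i"
  have t: "0 < t" using x by (simp add: t_def positive)
  \<comment> \<open>The far point gets so small a weight that the loss \<open>a * t\<close> is at
    most \<open>d\<close>; the cap \<open>1/2\<close> keeps the weight below 1.\<close>
  define a where "a = min (1/2) (d / t)"
  have a: "0 < a" "a < 1" "a * t \<le> d"
    using d t by (auto simp: a_def min_def field_simps)
  define z where "z = x + (1 / a) *\<^sub>R (y - x)"
  have z: "0 \<le> z"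
    using x xy a by (auto simp: z_def le_vec_iff intro!: add_nonneg_nonneg)
  have y: "y = a *\<^sub>R z + (1 - a) *\<^sub>R x"
    using a by (simp add: z_def algebra_simps)
  have "a * T z $ i + (1 - a) * t \<le> T y $ i"
    unfolding t_def by (subst y) (rule concave_component[OF z x a(1,2)])
  moreover have "0 < a * T z $ i" using a positive[OF z] by simp
  ultimately show "T x $ i \<le> T y $ i + d"
    using a(3) unfolding t_def[symmetric] by (simp add: algebra_simps)
qed

lemma T_mono: "0 \<le> x \<Longrightarrow> x \<le> y \<Longrightarrow> T x \<le> T y"
  using T_mono_component by (simp add: le_vec_iff)

text \<open>The point \<open>q\<close> is the convex combination of \<open>s *\<^sub>R q\<close> and
  \<open>0\<close> with weight \<open>1/s\<close>, and the contribution of \<open>T 0\<close> is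
  strictly positive.\<close>

lemma strictly_subhomogeneous:
  assumes q: "0 \<le> q" and s: "1 < s"
  shows "T (s *\<^sub>R q) $ i < s * T q $ i"
proof -
  have "1/s * T (s *\<^sub>R q) $ i + (1 - 1/s) * T 0 $ i
      \<le> T ((1/s) *\<^sub>R (s *\<^sub>R q) + (1 - 1/s) *\<^sub>R 0) $ i"
    using q s by (intro concave_component) (auto simp: le_vec_iff)
  moreover have "0 < (1 - 1/s) * T 0 $ i" using s positive[of 0] by simp
  ultimately have "1/s * T (s *\<^sub>R q) $ i < T q $ i" using s by simp
  then show ?thesis using s by (simp add: field_simps)
qed

lemma fixed_point_pos:
  assumes "0 \<le> p" "0 < c" "p = c *\<^sub>R T p"
  shows "0 < p $ i"
  using assms(2) positive[OF assms(1), of i] arg_cong[OF assms(3), of "\<lambda>v. v $ i"] by simp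

text \<open>If the least \<open>s\<close> with \<open>p \<le> s q\<close> exceeded 1, strict
  subhomogeneity would give a contradiction at an index where \<open>p\<close> and
  \<open>s q\<close> touch. Used in both directions with \<open>c = d\<close>, this yields
  uniqueness.\<close>

lemma fixed_point_mono:
  assumes p: "0 \<le> p" "0 < c" "p = c *\<^sub>R T p"
    and q: "0 \<le> q" "0 < d" "q = d *\<^sub>R T q" and cd: "c \<le> d"
  shows "p \<le> q"
proof -
  have qpos: "0 < q $ i" for i using fixed_point_pos[OF q] .
  obtain i where i: "\<And>j. p $ j / q $ j \<le> p $ i / q $ i"
    using ex_maximizer[of "\<lambda>j. p $ j / q $ j"] by blast
  define s where "s = p $ i / q $ i"
  have ps: "p $ j \<le> s * q $ j" for j
    using i[of j] qpos[of j] by (simp add: s_def pos_divide_le_eq)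
  have "s \<le> 1"
  proof (rule ccontr)
    assume "\<not> s \<le> 1"
    then have s: "1 < s" by simp
    have "p $ i = c * T p $ i" using arg_cong[OF p(3), of "\<lambda>v. v $ i"] by simp
    also have "\<dots> \<le> c * T (s *\<^sub>R q) $ i"
      using p ps by (intro mult_left_mono T_mono_component) (auto simp: le_vec_iff)
    also have "\<dots> < c * (s * T q $ i)"
      using p strictly_subhomogeneous[OF q(1) s] by simp
    also have "\<dots> \<le> d * (s * T q $ i)"
      using cd s positive[OF q(1)] by (intro mult_right_mono) (auto simp: less_imp_le)
    also have "\<dots> = s * q $ i" 
      using arg_cong[OF q(3), of "\<lambda>v. v $ i"] by simp
    also have "\<dots> = p $ i" using qpos[of i] by (simp add: s_def)
    finally show False by simp
  qed
  then have "s * q $ j \<le> q $ j" for j using qpos[of j] by simp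
  then show ?thesis using ps unfolding le_vec_iff by (meson order_trans)
qed

section \<open>The lower bounding matrix and its affine minorant of the mapping\<close>

lemma lower_bounding_matrix_bounds:
  shows lower_bounding_matrix_nonneg: "0 \<le> lower_bounding_matrix T $ i $ j"
    and lower_bounding_matrix_le:
      "0 < h \<Longrightarrow> lower_bounding_matrix T $ i $ j \<le> h * T (inverse h *\<^sub>R axis j 1) $ i"
proof -
  define f where "f h = h * T (inverse h *\<^sub>R axis j 1) $ i" for h
  have ax: "0 \<le> (a *\<^sub>R axis j 1 :: real ^ 'n)" if "0 \<le> a" for a
    using that by (simp add: le_vec_iff axis_def)
  have fpos: "0 < f h" if "0 < h" for h
    using that positive[OF ax, of "inverse h"] by (simp add: f_def)
  \<comment> \<open>Subhomogeneity with factor \<open>h' / h\<close> carries the argument for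
    \<open>h'\<close> to the one for \<open>h\<close>.\<close>
  have fmono: "f h \<le> f h'" if h: "0 < h" "h < h'" for h h'
  proof -
    have "h' / h > 1" using h by simp
    then have "T ((h' / h) *\<^sub>R inverse h' *\<^sub>R axis j 1) $ i < h' / h * T (inverse h' *\<^sub>R axis j 1) $ i"
      using h by (intro strictly_subhomogeneous ax) auto
    moreover have "h' / h * inverse h' = inverse h" using h by (simp add: field_simps)
    ultimately show ?thesis using h by (simp add: f_def field_simps)
  qed
  \<comment> \<open>As \<open>f\<close> is increasing and positive, its limit at 0 from the right
    exists and is its infimum, which yields both bounds.\<close>
  define L where "L = Inf (f ` {0<..})"
  have bdd: "bdd_below (f ` {0<..})"
    using fpos by (intro bdd_belowI2[of _ 0]) (auto intro: less_imp_le)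
  have L: "L \<le> f h" if "0 < h" for h
    unfolding L_def using bdd that by (intro cInf_lower) auto
  have "(f \<longlongrightarrow> L) (at_right 0)"
  proof (rule order_tendstoI)
    fix a assume "a < L"
    then show "eventually (\<lambda>h. a < f h) (at_right 0)"
      using L by (intro eventually_at_rightI[of 0 1]) (auto intro: less_le_trans)
  next
    fix a assume "L < a"
    then obtain h where h: "0 < h" "f h < a"
      unfolding L_def using cInf_lessD[of "f ` {0<..}" a] by auto
    then show "eventually (\<lambda>h. f h < a) (at_right 0)"
      using fmono by (intro eventually_at_rightI[of 0 h]) (auto intro: le_less_trans)
  qed
  then have "Lim (at_right 0) f = L" by (intro tendsto_Lim) simp_all
  then have LM: "lower_bounding_matrix T $ i $ j = L"
    by (simp add: lower_bounding_matrix_def f_def[abs_def])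
  show "0 \<le> lower_bounding_matrix T $ i $ j"
    unfolding LM L_def using fpos by (intro cInf_greatest) (auto intro: less_imp_le)
  show "lower_bounding_matrix T $ i $ j \<le> h * T (inverse h *\<^sub>R axis j 1) $ i" if "0 < h"
    using L[OF that] by (simp add: LM f_def)
qed

text \<open>The \<open>j\<close>-th column of the lower bounding matrix is the recession function of \<open>T\<close>
  at \<open>e\<^sub>j\<close>.\<close>
lemma recession_bound:
  assumes x: "0 \<le> x" and h: "0 \<le> h"
  shows "T x $ i + h * lower_bounding_matrix T $ i $ j \<le> T (x + h *\<^sub>R axis j 1) $ i"
proof (cases "h = 0")
  case False
  then have h: "0 < h" using h by simp
  let ?M = "lower_bounding_matrix T $ i $ j"
  show ?thesis
  proof (rule field_le_epsilon)
    fix d :: real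
    assume d: "0 < d"
    define t where "t = T x $ i"
    have t: "0 < t" using x by (simp add: t_def positive)
    define a where "a = min (1/2) (d / t)"
    have a: "0 < a" "a < 1" "a * t \<le> d"
      using d t by (auto simp: a_def min_def field_simps)
    \<comment> \<open>The point lies so far out on the ray that \<open>a *\<^sub>R z\<close> is
      exactly \<open>h *\<^sub>R axis j 1\<close>; the matrix entry is then bounded with step
      \<open>a / h\<close>.\<close>
    define z where "z = inverse (a / h) *\<^sub>R (axis j 1 :: real ^ 'n)"
    have z: "0 \<le> z" using a h by (simp add: z_def le_vec_iff axis_def)
    have "?M \<le> a / h * T z $ i"
      unfolding z_def using a h by (intro lower_bounding_matrix_le) simp
    then have "h * ?M \<le> a * T z $ i" using h by (simp add: field_simps)
    moreover have "a * T z $ i + (1 - a) * T x $ i \<le> T (a *\<^sub>R z + (1 - a) *\<^sub>R x) $ i"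
      by (rule concave_component[OF z x a(1,2)])
    moreover have "T (a *\<^sub>R z + (1 - a) *\<^sub>R x) $ i \<le> T (x + h *\<^sub>R axis j 1) $ i"
    proof (rule T_mono_component)
      show "0 \<le> a *\<^sub>R z + (1 - a) *\<^sub>R x"
        using a z x by (auto simp: le_vec_iff)
      have "a *\<^sub>R z = h *\<^sub>R axis j 1" using a by (simp add: z_def)
      moreover have "(1 - a) *\<^sub>R x \<le> x"
        using a x by (auto simp: le_vec_iff mult_le_cancel_right1 mult_left_le_one_le)
      ultimately show "a *\<^sub>R z + (1 - a) *\<^sub>R x \<le> x + h *\<^sub>R axis j 1"
        by (simp add: add.commute)
    qed
    ultimately show "T x $ i + h * ?M \<le> T (x + h *\<^sub>R axis j 1) $ i + d"
      using a(3) unfolding t_def[symmetric] by (simp add: algebra_simps)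
  qed
qed simp

text \<open>Starting at \<open>0\<close>, the vector \<open>x\<close> is built up one coordinate at
  a time, each step paying for one column through \<open>recession_bound\<close>.\<close>

lemma affine_lower_bound:
  assumes x: "0 \<le> x"
  shows "T 0 $ i + (lower_bounding_matrix T *v x) $ i \<le> T x $ i"
proof -
  let ?M = "lower_bounding_matrix T"
  have "T 0 $ i + (\<Sum>j\<in>S. ?M $ i $ j * x $ j) \<le> T (\<Sum>j\<in>S. x $ j *\<^sub>R axis j 1) $ i" for S
  proof (induction S rule: infinite_finite_induct)
    case (insert k S)
    have "0 \<le> (\<Sum>j\<in>S. x $ j *\<^sub>R axis j 1 :: real ^ 'n)"
      using x by (auto simp: le_vec_iff axis_def intro!: sum_nonneg)
    from recession_bound[OF this, of "x $ k" i k] insert x show ?case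
      by (simp add: le_vec_iff algebra_simps)
  qed simp_all
  from this[of UNIV] show ?thesis
    by (simp add: matrix_vector_mult_def basis_expansion scalar_mult_eq_scaleR[symmetric])
qed

text \<open>Positivity of \<open>T 0\<close> makes the affine bound strict, so \<open>p\<close>
  itself is a valid test vector in \<open>rho_less\<close>.\<close>

lemma rho_less_inverse:
  assumes p: "0 \<le> p" "0 < c" "p = c *\<^sub>R T p"
  shows "rho (lower_bounding_matrix T) < 1 / c"
proof (rule rho_less)
  show "0 \<le> lower_bounding_matrix T $ i $ j" for i j
    by (rule lower_bounding_matrix_nonneg)
  show "0 < p $ i" for i using fixed_point_pos[OF p] .
  show "(lower_bounding_matrix T *v p) $ i < 1 / c * p $ i" for i
  proof -
    have "(lower_bounding_matrix T *v p) $ i < T p $ i"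
      using affine_lower_bound[OF p(1), of i] positive[of 0 i] by simp
    also have "T p $ i = 1 / c * p $ i"
      using p(2) arg_cong[OF p(3), of "\<lambda>v. v $ i"] by simp
    finally show ?thesis .
  qed
qed

end

section \<open>Existence and uniqueness of the solution for a given budget\<close>

locale utility_problem = positive_concave T + norm_mono \<nu>
  for T :: "real ^ 'n \<Rightarrow> real ^ 'n" and \<nu> :: "real ^ 'n \<Rightarrow> real" +
  assumes T_continuous: "continuous_on {x. x \<ge> 0} T"
begin

lemma ex_fixed_point:
  assumes B: "0 < B"
  obtains p c where "0 \<le> p" "0 < c" "p = c *\<^sub>R T p" "\<nu> p = B"
proof -
  \<comment> \<open>Brouwer's theorem needs a convex domain, hence the ball part and not the sphere;
    the normalized map has values of norm exactly \<open>B\<close>, and so does its fixed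
    point.\<close>
  let ?K = "{p. 0 \<le> p \<and> \<nu> p \<le> B}"
  let ?c = "\<lambda>p. B / \<nu> (T p)"
  have npos: "0 < \<nu> (T p)" if "0 \<le> p" for p using that by (intro norm_pos T_nonzero)
  have norm_G: "\<nu> (?c p *\<^sub>R T p) = B" if "0 \<le> p" for p
    using npos[OF that] B by (simp add: norm_scale)
  have contT: "continuous_on ?K T" by (rule continuous_on_subset[OF T_continuous]) auto
  have contN: "continuous_on ?K (\<lambda>p. \<nu> (T p))"
    using continuous_on_compose[OF contT is_norm_continuous[OF norm_properties]]
    by (simp add: o_def)
  have "continuous_on ?K (\<lambda>p. ?c p *\<^sub>R T p)"
    using npos by (intro continuous_intros contN contT) (auto simp: less_imp_neq[symmetric])
  moreover have "(\<lambda>p. ?c p *\<^sub>R T p) \<in> ?K \<rightarrow> ?K"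
  proof (rule Pi_I)
    fix p assume p: "p \<in> ?K"
    then have "0 \<le> ?c p *\<^sub>R T p"
      using npos[of p] B T_nonneg[of p] by (auto simp: le_vec_iff)
    then show "?c p *\<^sub>R T p \<in> ?K" using p norm_G[of p] by simp
  qed
  moreover have "0 \<in> ?K" using norm_scale[of 0 0] B by simp
  then have "?K \<noteq> {}" by blast
  ultimately obtain p where p: "p \<in> ?K" "?c p *\<^sub>R T p = p"
    using brouwer[OF norm_ball_compact_convex] by blast
  show thesis
    using p B npos[of p] norm_G[of p] by (intro that[of p "?c p"]) auto
qed

text \<open>The fixed point of norm \<open>B\<close> is shown to be the unique maximizer, so the
  definite description in \<open>solution\<close> denotes it and inherits its properties.\<close>

lemma solution_properties:
  assumes B: "0 < B"
  defines "p \<equiv> power_function T \<nu> B" and "c \<equiv> utility_function T \<nu> B"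
  shows "0 \<le> p" "0 < c" "p = c *\<^sub>R T p" "\<nu> p = B"
proof -
  obtain q d where q: "0 \<le> q" "0 < d" "q = d *\<^sub>R T q" "\<nu> q = B"
    using ex_fixed_point[OF B] .
  have upper: "d' \<le> d" if f: "(q', d') \<in> feasible T \<nu> B" for q' d'
  proof (rule ccontr)
    assume "\<not> d' \<le> d"
    then have less: "d < d'" by simp
    from f have q': "0 \<le> q'" "0 < d'" "q' = d' *\<^sub>R T q'" "\<nu> q' \<le> B"
      by (auto simp: feasible_def)
    have "q \<le> q'" using fixed_point_mono[OF q(1-3) q'(1-3)] less by simp
    then have Tle: "T q \<le> T q'" by (rule T_mono[OF q(1)])
    \<comment> \<open>A larger utility \<open>d'\<close> would give \<open>q' = d' T q'\<close>,
      which dominates \<open>d' T q = (d' / d) q\<close>, a vector of norm above the budget.\<close>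
    have "B < d' / d * B" using less B q(2) by (simp add: field_simps)
    also have "\<dots> = \<nu> ((d' / d) *\<^sub>R q)" using q q' by (simp add: norm_scale)
    also have "(d' / d) *\<^sub>R q = d' *\<^sub>R T q"
      using q(2) by (subst q(3)) simp
    also have "\<nu> (d' *\<^sub>R T q) \<le> \<nu> (d' *\<^sub>R T q')"
      using q'(2) Tle T_nonneg[OF q(1)] by (intro norm_le) (auto simp: le_vec_iff)
    also have "\<dots> \<le> B" using q' by simp
    finally show False by simp
  qed
  have qfeas: "(q, d) \<in> feasible T \<nu> B" using q by (simp add: feasible_def)
  have "solution T \<nu> B = (q, d)"
    unfolding solution_def
  proof (rule the_equality)
    show "is_arg_max snd (\<lambda>s. s \<in> feasible T \<nu> B) (q, d)"
      using qfeas upper by (auto simp: is_arg_max_def not_less)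
  next
    fix s assume s: "is_arg_max snd (\<lambda>s. s \<in> feasible T \<nu> B) s"
    obtain q' d' where s_eq: "s = (q', d')" by (cases s)
    have f: "(q', d') \<in> feasible T \<nu> B" using s by (simp add: s_eq is_arg_max_def)
    have "d' = d"
      using s qfeas upper[OF f] by (force simp: s_eq is_arg_max_def)
    moreover from f have q': "0 \<le> q'" "0 < d'" "q' = d' *\<^sub>R T q'" by (auto simp: feasible_def)
    ultimately have "q' = q"
      using fixed_point_mono[OF q(1-3) q'] fixed_point_mono[OF q' q(1-3)] by (intro antisym) auto
    then show "s = (q, d)" using s_eq \<open>d' = d\<close> by simp
  qed
  then have "p = q" "c = d" by (simp_all add: p_def c_def power_function_def utility_function_def)
  then show "0 \<le> p" "0 < c" "p = c *\<^sub>R T p" "\<nu> p = B" using q by auto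
qed

section \<open>Energy efficiency: closed form, bounds, limit and supremum\<close>

lemma energy_efficiency_eq:
  assumes B: "0 < B" and \<mu>: "monotone_norm \<mu>"
  shows "energy_efficiency T \<nu> \<mu> B = 1 / \<mu> (T (power_function T \<nu> B))"
proof -
  interpret \<mu>: norm_mono \<mu> by unfold_locales (rule \<mu>)
  let ?p = "power_function T \<nu> B" and ?c = "utility_function T \<nu> B"
  note sol = solution_properties[OF B]
  have "\<mu> ?p = ?c * \<mu> (T ?p)"
    using sol(2) arg_cong[OF sol(3), of \<mu>] by (simp add: \<mu>.norm_scale)
  then show ?thesis using sol(2) by (simp add: energy_efficiency_def)
qed

text \<open>The solution has norm exactly \<open>B\<close>, so \<open>component_le\<close> squeezes
  each entry between 0 and a fixed multiple of \<open>B\<close>.\<close>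

lemma power_function_tendsto_0: "(power_function T \<nu> \<longlongrightarrow> 0) (at_right 0)"
proof (rule vec_tendstoI)
  fix i
  have lim: "((\<lambda>B. B / \<nu> (axis i 1)) \<longlongrightarrow> 0 / \<nu> (axis i 1)) (at_right 0)"
    using norm_pos[of "axis i 1"] by (intro tendsto_intros) (auto simp: axis_eq_0_iff)
  have "((\<lambda>B. power_function T \<nu> B $ i) \<longlongrightarrow> 0) (at_right 0)"
  proof (rule tendsto_sandwich[OF _ _ tendsto_const])
    show "eventually (\<lambda>B. 0 \<le> power_function T \<nu> B $ i) (at_right 0)"
      using solution_properties(1)
      by (intro eventually_at_rightI[of 0 1]) (auto simp: le_vec_iff)
    show "eventually (\<lambda>B. power_function T \<nu> B $ i \<le> B / \<nu> (axis i 1)) (at_right 0)"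
    proof (rule eventually_at_rightI[of 0 1])
      fix B :: real assume "B \<in> {0<..<1}"
      then have B: "0 < B" by simp
      show "power_function T \<nu> B $ i \<le> B / \<nu> (axis i 1)"
        using component_le[OF solution_properties(1)[OF B], of i]
        by (simp add: solution_properties(4)[OF B])
    qed simp
  qed (use lim in simp)
  then show "((\<lambda>B. power_function T \<nu> B $ i) \<longlongrightarrow> 0 $ i) (at_right 0)" by simp
qed

text \<open>The infinity norm estimate puts the solution entrywise below
  \<open>(B * \<beta>) *\<^sub>R 1\<close>; monotonicity of \<open>T\<close> and
  \<open>\<nu>\<close> then replaces the solution by this explicit vector.\<close>

lemma energy_efficiency_lower:
  assumes \<mu>: "monotone_norm \<mu>"
    and \<alpha>: "0 < \<alpha>" "\<And>p. \<alpha> * \<mu> p \<le> \<nu> p"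
    and \<beta>: "\<And>p. (\<And>i. 0 < p $ i) \<Longrightarrow> infnorm p \<le> \<beta> * \<nu> p"
    and B: "0 < B"
  shows "\<alpha> / \<nu> (T ((B * \<beta>) *\<^sub>R 1)) \<le> energy_efficiency T \<nu> \<mu> B"
proof -
  interpret \<mu>: norm_mono \<mu> by unfold_locales (rule \<mu>)
  let ?p = "power_function T \<nu> B"
  note sol = solution_properties[OF B]
  have "infnorm ?p \<le> \<beta> * B"
    using \<beta>[of ?p] fixed_point_pos[OF sol(1-3)] by (simp add: sol(4))
  then have "?p $ i \<le> B * \<beta>" for i
    using component_le_infnorm_cart[of ?p i] by (simp add: mult.commute)
  then have "?p \<le> (B * \<beta>) *\<^sub>R 1" by (simp add: le_vec_iff)
  then have "\<nu> (T ?p) \<le> \<nu> (T ((B * \<beta>) *\<^sub>R 1))"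
    by (intro norm_le T_mono T_nonneg sol(1))
  then have "\<alpha> * \<mu> (T ?p) \<le> \<nu> (T ((B * \<beta>) *\<^sub>R 1))" using \<alpha>(2)[of "T ?p"] by linarith
  moreover have "0 < \<mu> (T ?p)" by (intro \<mu>.norm_pos T_nonzero sol(1))
  \<comment> \<open>The denominator inherits positivity through the inequality just derived.\<close>
  moreover from calculation have "0 < \<nu> (T ((B * \<beta>) *\<^sub>R 1))"
    using \<alpha>(1) by (meson less_le_trans mult_pos_pos)
  ultimately show ?thesis by (simp add: energy_efficiency_eq[OF B \<mu>] field_simps)
qed

text \<open>The solution exhausts the budget, so \<open>B\<close> is at most
  \<open>\<alpha> * \<mu> ?p\<close>; the spectral bound \<open>?c * ?r < 1\<close> supplies the
  strictness.\<close>

lemma energy_efficiency_upper: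
  assumes \<mu>: "monotone_norm \<mu>" and rho: "0 < rho (lower_bounding_matrix T)"
    and \<alpha>: "\<And>p. \<nu> p \<le> \<alpha> * \<mu> p" and B: "0 < B"
  shows "energy_efficiency T \<nu> \<mu> B < \<alpha> / (rho (lower_bounding_matrix T) * B)"
proof -
  interpret \<mu>: norm_mono \<mu> by unfold_locales (rule \<mu>)
  let ?p = "power_function T \<nu> B" and ?c = "utility_function T \<nu> B"
  let ?r = "rho (lower_bounding_matrix T)"
  note sol = solution_properties[OF B]
  have "?p \<noteq> 0" using fixed_point_pos[OF sol(1-3)] by (metis less_irrefl zero_index)
  then have \<mu>pos: "0 < \<mu> ?p" by (rule \<mu>.norm_pos)
  have "?c * ?r < 1"
    using rho_less_inverse[OF sol(1-3)] sol(2) by (simp add: field_simps)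
  then have "?c * ?r * B < B" using B by simp
  also have "B \<le> \<alpha> * \<mu> ?p" using \<alpha>[of ?p] by (simp add: sol(4))
  finally show ?thesis
    using \<mu>pos rho B by (simp add: energy_efficiency_def field_simps)
qed

lemma energy_efficiency_le:
  assumes \<mu>: "monotone_norm \<mu>" and B: "0 < B"
  shows "energy_efficiency T \<nu> \<mu> B \<le> 1 / \<mu> (T 0)"
proof -
  interpret \<mu>: norm_mono \<mu> by unfold_locales (rule \<mu>)
  note sol = solution_properties[OF B]
  have "\<mu> (T 0) \<le> \<mu> (T (power_function T \<nu> B))"
    by (intro \<mu>.norm_le T_mono T_nonneg sol(1) order_refl)
  moreover have "0 < \<mu> (T 0)" by (intro \<mu>.norm_pos T_nonzero order_refl)
  ultimately show ?thesis
    unfolding energy_efficiency_eq[OF B \<mu>] by (intro divide_left_mono) auto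
qed

lemma energy_efficiency_tendsto:
  assumes \<mu>: "monotone_norm \<mu>"
  shows "(energy_efficiency T \<nu> \<mu> \<longlongrightarrow> 1 / \<mu> (T 0)) (at_right 0)"
proof -
  interpret \<mu>: norm_mono \<mu> by unfold_locales (rule \<mu>)
  have ev: "eventually (\<lambda>B :: real. 0 < B) (at_right 0)"
    by (rule eventually_at_right_less)
  have "((\<lambda>B. T (power_function T \<nu> B)) \<longlongrightarrow> T 0) (at_right 0)"
    by (rule continuous_on_tendsto_compose[OF T_continuous power_function_tendsto_0])
      (auto intro: eventually_mono[OF ev] solution_properties(1))
  then have "((\<lambda>B. \<mu> (T (power_function T \<nu> B))) \<longlongrightarrow> \<mu> (T 0)) (at_right 0)"
    by (rule continuous_on_tendsto_compose[OF is_norm_continuous[OF \<mu>.norm_properties, of UNIV]])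
      auto
  moreover have "\<mu> (T 0) \<noteq> 0"
    using \<mu>.norm_pos[OF T_nonzero[OF order_refl]] by simp
  ultimately have "((\<lambda>B. 1 / \<mu> (T (power_function T \<nu> B))) \<longlongrightarrow> 1 / \<mu> (T 0)) (at_right 0)"
    by (intro tendsto_intros)
  then show ?thesis
    by (rule Lim_transform_eventually)
      (auto intro: eventually_mono[OF ev] simp: energy_efficiency_eq[OF _ \<mu>])
qed

text \<open>The value is an upper bound at every budget and also the limit at 0, hence the supremum.
  Boundedness is stated because a real \<open>SUP\<close> is meaningful only with it.\<close>

lemma energy_efficiency_SUP:
  assumes \<mu>: "monotone_norm \<mu>"
  shows "bdd_above (energy_efficiency T \<nu> \<mu> ` {0<..})"
    and "(SUP B\<in>{0<..}. energy_efficiency T \<nu> \<mu> B) = 1 / \<mu> (T 0)"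
proof -
  show bdd: "bdd_above (energy_efficiency T \<nu> \<mu> ` {0<..})"
    using energy_efficiency_le[OF \<mu>] by (intro bdd_aboveI2[of _ _ "1 / \<mu> (T 0)"]) auto
  show "(SUP B\<in>{0<..}. energy_efficiency T \<nu> \<mu> B) = 1 / \<mu> (T 0)"
  proof (rule antisym)
    show "(SUP B\<in>{0<..}. energy_efficiency T \<nu> \<mu> B) \<le> 1 / \<mu> (T 0)"
      using energy_efficiency_le[OF \<mu>] by (intro cSUP_least) auto
    show "1 / \<mu> (T 0) \<le> (SUP B\<in>{0<..}. energy_efficiency T \<nu> \<mu> B)"
    proof (rule tendsto_upperbound[OF energy_efficiency_tendsto[OF \<mu>]])
      show "eventually (\<lambda>B. energy_efficiency T \<nu> \<mu> B
          \<le> (SUP B\<in>{0<..}. energy_efficiency T \<nu> \<mu> B)) (at_right 0)"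
        by (rule eventually_at_rightI[of 0 1]) (auto intro!: cSUP_upper bdd)
    qed simp
  qed
qed

end

theorem proposition5:
  fixes T :: "real ^ 'n \<Rightarrow> real ^ 'n"
    and norm_a norm_b :: "real ^ 'n \<Rightarrow> real"
    and M :: "real ^ 'n ^ 'n"
    and E :: "real \<Rightarrow> real"
  assumes T_cont: "continuous_on {x. x \<ge> 0} T"
    and T_concave: "concave_mapping T"
    and T_pos: "\<And>x i. x \<ge> 0 \<Longrightarrow> T x $ i > 0"
    and M_def: "M = lower_bounding_matrix T"
    and norm_a: "monotone_norm norm_a"
    and norm_b: "monotone_norm norm_b"
    and E_def: "E = energy_efficiency T norm_a norm_b"
  shows "(\<forall>\<alpha>1 > 0. \<forall>\<beta> > 0.
       (\<forall>p. \<alpha>1 * norm_b p \<le> norm_a p) \<longrightarrow>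
       (\<forall>p. (\<forall>i. p $ i > 0) \<longrightarrow> infnorm p \<le> \<beta> * norm_a p) \<longrightarrow>
       (\<forall>pbar > 0. \<alpha>1 / norm_a (T ((pbar * \<beta>) *\<^sub>R 1)) \<le> E pbar)) \<and>
     (rho M > 0 \<longrightarrow>
       (\<forall>\<alpha>2 > 0. (\<forall>p. norm_a p \<le> \<alpha>2 * norm_b p) \<longrightarrow>
          (\<forall>pbar > 0. E pbar < \<alpha>2 / (rho M * pbar)))) \<and>
     ((E \<longlongrightarrow> 1 / norm_b (T 0)) (at_right 0) \<and>
     bdd_above (E ` {0<..}) \<and> (SUP pbar\<in>{0<..}. E pbar) = 1 / norm_b (T 0)) \<and>
     (rho M > 0 \<longrightarrow>
       (\<forall>\<alpha>2 > 0. (\<forall>p. norm_a p \<le> \<alpha>2 * norm_b p) \<longrightarrow>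
          (let k = norm_b (T 0) / rho M in
           \<forall>pbar > 0. E pbar \<le>
             (if pbar \<ge> k then \<alpha>2 / (rho M * pbar) else 1 / norm_b (T 0)))))"
proof -
  interpret utility_problem T norm_a
    by unfold_locales (fact T_concave T_pos norm_a T_cont)+
  have upper: "E pbar < \<alpha>2 / (rho M * pbar)"
    if "0 < rho M" "\<forall>p. norm_a p \<le> \<alpha>2 * norm_b p" "0 < pbar" for \<alpha>2 pbar
    using energy_efficiency_upper[OF norm_b] that by (simp add: E_def M_def)
  \<comment> \<open>The two cases of the combined bound come from the weak form of
    \<open>upper\<close> and from \<open>energy_efficiency_le\<close>.\<close>
  show ?thesis
    unfolding Let_def
    using energy_efficiency_lower[OF norm_b] upper less_imp_le[OF upper]
      energy_efficiency_tendsto[OF norm_b] energy_efficiency_SUP[OF norm_b]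
      energy_efficiency_le[OF norm_b]
    by (simp add: E_def)
qed

end
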